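(* Consider the $T_{LNB}$ model with $c_1=0.5$, $c_2=0.55$, and with parameters $c_3>0$, $k>0$. The equilibrium $E_2$ of the $T_{LNB}$ model is a strictly positive, locally stable equilibrium if and only if $$LS_{LNB}^1>0,\quad LS_{LNB}^2<0,\quad LS_{LNB}^3<0\quad\text{and}\quad LS_{LNB}^4<0,$$ where $LS_{LNB}^1=20\,c_3-1$, $LS_{LNB}^2=20\,c_3-21$, $$LS_{LNB}^3=40000\,c_3^3k-218800\,c_3^2k+16000\,c_3^2+212860\,c_3k-174400\,c_3-28581\,k-59960,$$ $$\begin{aligned}LS_{LNB}^4={}&3200000\,c_3^6k^2-3200000\,c_3^5k^2+3200000\,c_3^5k-14704000\,c_3^4k^2-4800000\,c_3^4k\\&+28668800\,c_3^3k^2+800000\,c_3^4+11776000\,c_3^3k-15143500\,c_3^2k^2+160000\,c_3^3\\&+11631200\,c_3^2k+9660\,c_3k^2-1940000\,c_3^2-25391060\,c_3k+1166445\,k^2\\&-15682800\,c_3+1955352\,k-15115275.\end{aligned}$$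
   Context: The $T_{LNB}$ model is the 3-dimensional discrete dynamical system with parameters $c_1,c_2,c_3>0$, $k>0$ given by $$\begin{aligned}x(t+1)&=\tfrac12\left[2x(t)+y(t)+z(t)-c_1\big(x(t)+y(t)+z(t)\big)^2\right],\\ y(t+1)&=\sqrt{\tfrac{x(t)+z(t)}{c_2}}-x(t)-z(t),\\ z(t+1)&=z(t)+kz(t)\left[\tfrac{x(t)+y(t)}{(x(t)+y(t)+z(t))^2}-c_3\right].\end{aligned}$$ Its equilibrium $E_2$ is $$E_2=\left(\frac{2(c_2+c_3-c_1)}{(c_1+c_2+c_3)^2},\frac{2(c_1+c_3-c_2)}{(c_1+c_2+c_3)^2},\frac{2(c_1+c_2-c_3)}{(c_1+c_2+c_3)^2}\right).$$ Convention: an equilibrium is called locally stable if all (complex) eigenvalues of the Jacobian matrix of the iteration map at that equilibrium lie in the open unit disk $|\lambda|<1$ (linearized asymptotic stability, equivalent to the strict Schur-Cohn inequalities for the characteristic polynomial). Only strictly positive equilibria (all three coordinates $>0$) are considered. *)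

theory Defs
  imports "HOL-Analysis.Analysis"
begin

(* Points are triples (x, y, z), stored as components 1, 2, 3 of real^3. Division by zero
   and square roots of negative numbers take their HOL values (x / 0 = 0, sqrt (- x) = - sqrt x)
   where x + y + z = 0 or x + z < 0; this does not affect the map near a point with
   strictly positive coordinates. *)
definition tlnb_map :: "real \<Rightarrow> real \<Rightarrow> real \<Rightarrow> real \<Rightarrow> real ^ 3 \<Rightarrow> real ^ 3" where
  "tlnb_map c1 c2 c3 k p =
    (let x = p $ 1; y = p $ 2; z = p $ 3 in
      vector
        [1 / 2 * (2 * x + y + z - c1 * (x + y + z)\<^sup>2),
         sqrt ((x + z) / c2) - x - z,
         z + k * z * ((x + y) / (x + y + z)\<^sup>2 - c3)])"

definition tlnb_E2 :: "real \<Rightarrow> real \<Rightarrow> real \<Rightarrow> real ^ 3" where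
  "tlnb_E2 c1 c2 c3 =
    vector
      [2 * (c2 + c3 - c1) / (c1 + c2 + c3)\<^sup>2,
       2 * (c1 + c3 - c2) / (c1 + c2 + c3)\<^sup>2,
       2 * (c1 + c2 - c3) / (c1 + c2 + c3)\<^sup>2]"

definition is_equilibrium :: "('a \<Rightarrow> 'a) \<Rightarrow> 'a \<Rightarrow> bool" where
  "is_equilibrium f p \<longleftrightarrow> f p = p"

definition strictly_positive :: "real ^ 'n \<Rightarrow> bool" where
  "strictly_positive p \<longleftrightarrow> (\<forall>i. p $ i > 0)"

definition complex_eigenvalue :: "real ^ 'n ^ 'n \<Rightarrow> complex \<Rightarrow> bool" where
  "complex_eigenvalue A \<mu> \<longleftrightarrow>
    (\<exists>v :: complex ^ 'n. v \<noteq> 0 \<and> map_matrix complex_of_real A *v v = \<mu> *s v)"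

(* Linearized asymptotic stability. The library's jacobian is only meaningful at points of
   differentiability, hence the first conjunct. *)
definition locally_stable :: "(real ^ 'n \<Rightarrow> real ^ 'n) \<Rightarrow> real ^ 'n \<Rightarrow> bool" where
  "locally_stable f p \<longleftrightarrow>
    f differentiable (at p) \<and>
    (\<forall>\<mu>. complex_eigenvalue (jacobian f (at p)) \<mu> \<longrightarrow> cmod \<mu> < 1)"

definition LS1 :: "real \<Rightarrow> real" where
  "LS1 c3 = 20 * c3 - 1"

definition LS2 :: "real \<Rightarrow> real" where
  "LS2 c3 = 20 * c3 - 21"

definition LS3 :: "real \<Rightarrow> real \<Rightarrow> real" where
  "LS3 c3 k =
    40000 * c3 ^ 3 * k - 218800 * c3 ^ 2 * k + 16000 * c3 ^ 2 + 212860 * c3 * k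
    - 174400 * c3 - 28581 * k - 59960"

definition LS4 :: "real \<Rightarrow> real \<Rightarrow> real" where
  "LS4 c3 k =
    3200000 * c3 ^ 6 * k ^ 2 - 3200000 * c3 ^ 5 * k ^ 2 + 3200000 * c3 ^ 5 * k
    - 14704000 * c3 ^ 4 * k ^ 2 - 4800000 * c3 ^ 4 * k + 28668800 * c3 ^ 3 * k ^ 2
    + 800000 * c3 ^ 4 + 11776000 * c3 ^ 3 * k - 15143500 * c3 ^ 2 * k ^ 2
    + 160000 * c3 ^ 3 + 11631200 * c3 ^ 2 * k + 9660 * c3 * k ^ 2 - 1940000 * c3 ^ 2
    - 25391060 * c3 * k + 1166445 * k ^ 2 - 15682800 * c3 + 1955352 * k - 15115275"

end

theory Submission
  imports Defs
begin

text \<open>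
  The characteristic polynomial p of the Jacobian at the equilibrium is a real cubic, hence splits
  over the reals into a linear and a quadratic factor, and the Schur-Cohn conditions can be checked
  on the factors. With n = 20 c3 + 21 one finds p(1) = k n (21 - 20 c3) / 1760,
  -p(-1) = -LS3 / (1760 n), and the determinant condition is -LS4 / (38720 n^2) > 0. The strict
  inequalities LS1 > 0 and LS2 < 0 are positivity of the equilibrium, which also makes p(1)
  positive. The usual further condition that the product of the eigenvalues is smaller than 1 in
  modulus is not independent: the trace is less than 2 and, given LS3 < 0, the constant
  coefficient is less than 1, which suffices.
\<close>

section \<open>Root location for real quadratics and cubics\<close>

text \<open>Non-real roots are conjugate with squared modulus \<open>c\<close>; for real roots
  \<open>u\<close>, \<open>v\<close> the three conditions are the signs of
  \<open>(1 - u) * (1 - v)\<close>, \<open>(1 + u) * (1 + v)\<close> and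
  \<open>1 - u * v\<close>.\<close>

lemma quadratic_roots_in_unit_disc_iff:
  fixes b c :: real
  shows "(\<forall>z::complex. z\<^sup>2 + of_real b * z + of_real c = 0 \<longrightarrow> cmod z < 1) \<longleftrightarrow>
    1 + b + c > 0 \<and> 1 - b + c > 0 \<and> c < 1"
proof (cases "b\<^sup>2 < 4 * c")
  case True
  have norm: "(cmod z)\<^sup>2 = c" if "z\<^sup>2 + of_real b * z + of_real c = 0" for z :: complex
  proof -
    obtain u v where z: "z = Complex u v" by (cases z)
    have re: "u\<^sup>2 - v\<^sup>2 + b * u + c = 0" and im: "v * (2 * u + b) = 0"
      using that by (auto simp: z complex_eq_iff power2_eq_square algebra_simps)
    have "v \<noteq> 0"
    proof
      assume "v = 0"
      then have "(2 * u + b)\<^sup>2 = b\<^sup>2 - 4 * c"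
        using re by (simp add: power2_eq_square algebra_simps)
      then show False using True by (smt (verit) zero_le_power2)
    qed
    then have "b = - 2 * u" using im by simp
    then show ?thesis unfolding z cmod_power2 using re by (simp add: power2_eq_square)
  qed
  \<comment> \<open>An explicit root makes the universal statement non-vacuous, so that it forces
    \<open>c < 1\<close>.\<close>
  define z where "z = Complex (- b / 2) (sqrt (c - b\<^sup>2 / 4))"
  have "(sqrt (c - b\<^sup>2 / 4))\<^sup>2 = c - b\<^sup>2 / 4"
    using True by simp
  then have root: "z\<^sup>2 + of_real b * z + of_real c = 0"
    by (auto simp: z_def complex_eq_iff power2_eq_square field_simps)
  \<comment> \<open>With \<open>b\<^sup>2 < 4 * c\<close> this yields the first two conditions
    outright; only \<open>c < 1\<close> still carries information.\<close>
  have "4 * c \<le> (1 + c)\<^sup>2"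
    using zero_le_power2[of "1 - c"] by (simp add: power2_eq_square algebra_simps)
  moreover have "c > 0" using True by (smt (verit) zero_le_power2)
  ultimately have "\<bar>b\<bar> < 1 + c"
    using True by (intro power2_less_imp_less[of "\<bar>b\<bar>"]) auto
  moreover have "cmod w < 1 \<longleftrightarrow> (cmod w)\<^sup>2 < 1" for w
    using abs_square_less_1[of "cmod w"] by simp
  ultimately show ?thesis using norm root by auto
next
  case False
  define s where "s = sqrt (b\<^sup>2 - 4 * c)"
  define u where "u = (- b + s) / 2"
  define v where "v = (- b - s) / 2"
  have "s\<^sup>2 = b\<^sup>2 - 4 * c" using False by (simp add: s_def)
  then have b: "b = - (u + v)" and c: "c = u * v"
    by (auto simp: u_def v_def power2_eq_square field_simps)
  have "z\<^sup>2 + of_real b * z + of_real c = (z - of_real u) * (z - of_real v)" for z :: complex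
    by (simp add: b c power2_eq_square algebra_simps)
  then have "(\<forall>z::complex. z\<^sup>2 + of_real b * z + of_real c = 0 \<longrightarrow> cmod z < 1) \<longleftrightarrow>
      \<bar>u\<bar> < 1 \<and> \<bar>v\<bar> < 1"
    by auto
  also have "\<dots> \<longleftrightarrow> (1 - u) * (1 - v) > 0 \<and> (1 + u) * (1 + v) > 0 \<and> u * v < 1"
  proof
    assume "\<bar>u\<bar> < 1 \<and> \<bar>v\<bar> < 1"
    moreover from this have "\<bar>u * v\<bar> < 1"
      using mult_strict_mono'[of "\<bar>u\<bar>" 1 "\<bar>v\<bar>" 1] by (auto simp: abs_mult)
    ultimately show "(1 - u) * (1 - v) > 0 \<and> (1 + u) * (1 + v) > 0 \<and> u * v < 1" by auto
  next
    assume *: "(1 - u) * (1 - v) > 0 \<and> (1 + u) * (1 + v) > 0 \<and> u * v < 1"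
    \<comment> \<open>Positive products alone would allow both roots above 1 or both below -1;
      \<open>u * v < 1\<close> excludes this.\<close>
    have "\<not> (u > 1 \<and> v > 1)" "\<not> (u < -1 \<and> v < -1)"
      using * mult_strict_mono'[of 1 u 1 v] mult_strict_mono'[of 1 "-u" 1 "-v"] by auto
    then show "\<bar>u\<bar> < 1 \<and> \<bar>v\<bar> < 1"
      using * by (auto simp: zero_less_mult_iff)
  qed
  also have "\<dots> \<longleftrightarrow> 1 + b + c > 0 \<and> 1 - b + c > 0 \<and> c < 1"
    by (simp add: b c algebra_simps)
  finally show ?thesis .
qed

text \<open>Here \<open>r\<close> is a real root of a cubic and \<open>b\<close>, \<open>c\<close>
  are the coefficients of its quadratic cofactor; the right-hand side is expressible in the
  coefficients of the cubic. If \<open>u\<close>, \<open>v\<close> are the roots of the cofactor,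
  \<open>1 + b * r + c * r\<^sup>2\<close> is \<open>(1 - r * u) * (1 - r * v)\<close>. The
  hypothesis bounds the sum of all three roots by 2.\<close>

lemma schur_cohn_factored:
  fixes r b c :: real
  assumes "b - r > - 2"
  shows "\<bar>r\<bar> < 1 \<and> 1 + b + c > 0 \<and> 1 - b + c > 0 \<and> c < 1 \<longleftrightarrow>
    (1 - r) * (1 + b + c) > 0 \<and> (1 + r) * (1 - b + c) > 0 \<and>
    (1 - c) * (1 + b * r + c * r\<^sup>2) > 0 \<and> r * c > - 1"
    (is "?roots \<longleftrightarrow> ?coeffs")
proof
  assume *: ?roots
  \<comment> \<open>This bounds \<open>1 + b * r + c * r\<^sup>2\<close> from below by
    \<open>(1 - \<bar>r\<bar>) * (1 - c * \<bar>r\<bar>)\<close>.\<close>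
  then have "\<bar>b * r\<bar> \<le> (1 + c) * \<bar>r\<bar>"
    by (auto simp: abs_mult intro!: mult_right_mono)
  moreover have "(1 - \<bar>r\<bar>) * (1 - c * \<bar>r\<bar>) > 0"
  proof -
    have "c * \<bar>r\<bar> \<le> 1 * \<bar>r\<bar>" using * by (intro mult_right_mono) auto
    then show ?thesis using * by auto
  qed
  moreover have "(1 - \<bar>r\<bar>) * (1 - c * \<bar>r\<bar>) = 1 - (1 + c) * \<bar>r\<bar> + c * r\<^sup>2"
    by (simp add: power2_eq_square algebra_simps)
  ultimately have "1 + b * r + c * r\<^sup>2 > 0"
    by linarith
  moreover have "\<bar>r * c\<bar> < 1"
    using * mult_strict_mono'[of "\<bar>r\<bar>" 1 "\<bar>c\<bar>" 1] by (auto simp: abs_mult)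
  ultimately show ?coeffs using * by auto
next
  assume *: ?coeffs
  then have "r \<noteq> 1" "r \<noteq> - 1" by auto
  then consider "\<bar>r\<bar> < 1" | "r > 1" | "r < - 1"
    by linarith
  then show ?roots
  proof cases
    case 1
    then have pos: "1 + b + c > 0" "1 - b + c > 0"
      using * by (auto simp: zero_less_mult_iff)
    have "c < 1"
    proof (rule ccontr)
      assume "\<not> c < 1"
      then have "c > 1" and neg: "1 + b * r + c * r\<^sup>2 < 0"
        using * by (auto simp: zero_less_mult_iff)
      \<comment> \<open>Completing the square: negativity forces
        \<open>b\<^sup>2 > 4 * c > 4\<close>, so the cofactor has two real roots of the same sign,
        both outside the disc.\<close>
      have "4 * c * (1 + b * r + c * r\<^sup>2) = (2 * c * r + b)\<^sup>2 + 4 * c - b\<^sup>2"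
        by (simp add: power2_eq_square algebra_simps)
      moreover have "4 * c * (1 + b * r + c * r\<^sup>2) < 0"
        using \<open>c > 1\<close> neg by (simp add: mult_less_0_iff)
      ultimately have "2\<^sup>2 < b\<^sup>2"
        using \<open>c > 1\<close> by (smt (verit) zero_le_power2 four_x_squared one_power2)
      then have "\<bar>b\<bar> > 2"
        by (metis abs_le_square_iff abs_numeral not_le)
      have "b * r < 0"
        using neg \<open>c > 1\<close> by (smt (verit) zero_le_power2 mult_nonneg_nonneg)
      show False
      \<comment> \<open>Both below -1: \<open>1 + b * r + c * r\<^sup>2\<close> would be at least
        \<open>(1 + r) * (1 + r * c) > 0\<close>. Both above 1: the trace bound fails.\<close>
      proof (cases "b > 0")
        case True
        then have "b > 2" "r < 0" using \<open>\<bar>b\<bar> > 2\<close> \<open>b * r < 0\<close> by (auto simp: mult_less_0_iff)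
        then have "(1 + r) * (1 + r * c) > 0" using * 1 by auto
        moreover have "(1 + c) * r \<le> b * r"
          using pos \<open>r < 0\<close> by (intro mult_right_mono_neg) auto
        ultimately show False using neg by (simp add: algebra_simps power2_eq_square)
      next
        case False
        then have "b < - 2" "r > 0" using \<open>\<bar>b\<bar> > 2\<close> \<open>b * r < 0\<close> by (auto simp: mult_less_0_iff)
        then show False using assms by auto
      qed
    qed
    then show ?thesis using 1 pos by simp
  next
    case 2
    then have neg: "1 + b + c < 0" using * by (auto simp: zero_less_mult_iff)
    \<comment> \<open>The trace bound gives \<open>b > r - 2 > -1\<close>. Then
      \<open>1 + b * r + c * r\<^sup>2\<close> is at most \<open>(1 - r) * (1 - c * r) < 0\<close>,
      against the third condition.\<close>
    then have "c < 0" using assms 2 by auto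
    have "(1 - r) * (1 - c * r) < 0"
      using 2 \<open>c < 0\<close> by (intro mult_neg_pos) (auto simp: mult_less_0_iff intro: less_trans[of _ 0])
    moreover have "b * r \<le> - (1 + c) * r"
      using neg 2 by (intro mult_right_mono) auto
    ultimately have "1 + b * r + c * r\<^sup>2 < 0" by (simp add: algebra_simps power2_eq_square)
    then show ?thesis using * \<open>c < 0\<close> by (auto simp: zero_less_mult_iff)
  next
    case 3
    then have neg: "1 - b + c < 0" "1 + b + c > 0" using * by (auto simp: zero_less_mult_iff)
    \<comment> \<open>Here \<open>r * c > - 1\<close> takes the place of the trace bound, and the
      upper estimate is \<open>(1 + r) * (1 + r * c) < 0\<close>.\<close>
    have "c < 1"
    proof (rule ccontr)
      assume "\<not> c < 1"
      then have "r * c \<le> r * 1" using 3 by (intro mult_left_mono_neg) auto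
      then show False using * 3 by linarith
    qed
    moreover have "(1 + r) * (1 + r * c) < 0"
      using * 3 by (auto simp: mult_less_0_iff)
    moreover have "b * r \<le> (1 + c) * r"
      using neg 3 by (intro mult_right_mono_neg) auto
    ultimately have "1 + b * r + c * r\<^sup>2 < 0" by (simp add: algebra_simps power2_eq_square)
    with \<open>c < 1\<close> show ?thesis using * by (auto simp: zero_less_mult_iff)
  qed
qed

lemma real_cubic_has_root:
  fixes a2 a1 a0 :: real
  obtains r where "r ^ 3 + a2 * r\<^sup>2 + a1 * r + a0 = 0"
proof -
  \<comment> \<open>At \<open>M\<close> and \<open>- M\<close> the lower-order terms are at most
    \<open>M ^ 3\<close> in modulus, so the intermediate value theorem applies.\<close>
  define M where "M = 1 + \<bar>a2\<bar> + \<bar>a1\<bar> + \<bar>a0\<bar>"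
  define p where "p x = x ^ 3 + a2 * x\<^sup>2 + a1 * x + a0" for x
  have M: "M \<ge> 1" by (simp add: M_def)
  have bound: "\<bar>a2 * x\<^sup>2 + a1 * x + a0\<bar> \<le> M ^ 3" if "\<bar>x\<bar> = M" for x
  proof -
    have "\<bar>a2 * x\<^sup>2 + a1 * x + a0\<bar> \<le> \<bar>a2 * x\<^sup>2\<bar> + \<bar>a1 * x\<bar> + \<bar>a0\<bar>"
      by linarith
    also have "\<dots> = \<bar>a2\<bar> * M\<^sup>2 + \<bar>a1\<bar> * M + \<bar>a0\<bar>"
      by (simp add: abs_mult flip: that)
    also have "\<dots> \<le> \<bar>a2\<bar> * M\<^sup>2 + \<bar>a1\<bar> * M\<^sup>2 + \<bar>a0\<bar> * M\<^sup>2"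
      using M power_increasing[of 1 2 M] mult_left_mono[of M "M\<^sup>2" "\<bar>a1\<bar>"]
        mult_left_mono[of 1 "M\<^sup>2" "\<bar>a0\<bar>"] one_le_power[of M 2] by auto
    also have "\<dots> = (M - 1) * M\<^sup>2" by (simp add: M_def algebra_simps)
    also have "\<dots> \<le> M * M\<^sup>2" by (intro mult_right_mono) auto
    finally show ?thesis by (simp add: power3_eq_cube power2_eq_square)
  qed
  have "p (- M) \<le> 0" "0 \<le> p M"
    using bound[of "- M"] bound[of M] M by (auto simp: p_def)
  moreover have "continuous_on {- M..M} p"
    unfolding p_def by (intro continuous_intros)
  ultimately obtain r where "p r = 0"
    using IVT'[of p "- M" 0 M] M by auto
  then show ?thesis using that by (simp add: p_def)
qed

text \<open>
  The expression 1 - a1 + a2 a0 - a0^2 is the product of 1 - uv over the pairs u, v of roots.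
  The bound on the trace excludes the case of two real roots greater than 1, the bound a0 < 1
  that of two real roots less than -1.
\<close>
lemma schur_cohn_cubic:
  fixes a2 a1 a0 :: real
  assumes "a2 > - 2"
  shows "(\<forall>z::complex. z ^ 3 + of_real a2 * z\<^sup>2 + of_real a1 * z + of_real a0 = 0 \<longrightarrow> cmod z < 1) \<longleftrightarrow>
    1 + a2 + a1 + a0 > 0 \<and> 1 - a2 + a1 - a0 > 0 \<and> 1 - a1 + a2 * a0 - a0\<^sup>2 > 0 \<and> a0 < 1"
proof -
  obtain r where r: "r ^ 3 + a2 * r\<^sup>2 + a1 * r + a0 = 0"
    by (rule real_cubic_has_root)
  \<comment> \<open>Division by \<open>z - r\<close>; the vanishing remainder is what gives
    \<open>a0 = - r * c\<close>.\<close>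
  define b where "b = a2 + r"
  define c where "c = a1 + r * b"
  have a2: "a2 = b - r" and a1: "a1 = c - r * b" by (auto simp: b_def c_def)
  have a0: "a0 = - r * c"
    using r by (simp add: b_def c_def power3_eq_cube power2_eq_square algebra_simps)
  have "z ^ 3 + of_real a2 * z\<^sup>2 + of_real a1 * z + of_real a0 =
      (z - of_real r) * (z\<^sup>2 + of_real b * z + of_real c)" for z :: complex
    by (simp add: a2 a1 a0 power3_eq_cube power2_eq_square algebra_simps)
  then have "(\<forall>z::complex. z ^ 3 + of_real a2 * z\<^sup>2 + of_real a1 * z + of_real a0 = 0 \<longrightarrow> cmod z < 1)
      \<longleftrightarrow> \<bar>r\<bar> < 1 \<and> (\<forall>z::complex. z\<^sup>2 + of_real b * z + of_real c = 0 \<longrightarrow> cmod z < 1)"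
    by auto
  also have "\<dots> \<longleftrightarrow> \<bar>r\<bar> < 1 \<and> 1 + b + c > 0 \<and> 1 - b + c > 0 \<and> c < 1"
    by (simp add: quadratic_roots_in_unit_disc_iff)
  also have "\<dots> \<longleftrightarrow> (1 - r) * (1 + b + c) > 0 \<and> (1 + r) * (1 - b + c) > 0 \<and>
      (1 - c) * (1 + b * r + c * r\<^sup>2) > 0 \<and> r * c > - 1"
    using assms by (intro schur_cohn_factored) (simp add: a2)
  also have "(1 - r) * (1 + b + c) = 1 + a2 + a1 + a0"
    by (simp add: a2 a1 a0 algebra_simps)
  also have "(1 + r) * (1 - b + c) = 1 - a2 + a1 - a0"
    by (simp add: a2 a1 a0 algebra_simps)
  also have "(1 - c) * (1 + b * r + c * r\<^sup>2) = 1 - a1 + a2 * a0 - a0\<^sup>2"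
    by (simp add: a2 a1 a0 power2_eq_square algebra_simps)
  also have "r * c > - 1 \<longleftrightarrow> a0 < 1"
    by (auto simp: a0)
  finally show ?thesis .
qed

section \<open>Eigenvalues and the characteristic polynomial\<close>

lemma complex_eigenvalue_iff_det:
  fixes A :: "real ^ 'n ^ 'n"
  shows "complex_eigenvalue A \<mu> \<longleftrightarrow> det (mat \<mu> - map_matrix complex_of_real A) = 0"
proof -
  have "(mat \<mu> - M) *v v = \<mu> *s v - M *v v" for M :: "complex ^ 'n ^ 'n" and v
    unfolding matrix_vector_mult_diff_rdistrib
    by (simp add: vec_eq_iff matrix_vector_mult_def mat_def if_distrib[of "\<lambda>a. a * _"] cong: if_cong)
  then have "complex_eigenvalue A \<mu> \<longleftrightarrow>
      \<not> (\<forall>v. (mat \<mu> - map_matrix complex_of_real A) *v v = 0 \<longrightarrow> v = 0)"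
    unfolding complex_eigenvalue_def by (metis eq_iff_diff_eq_0)
  also have "\<dots> \<longleftrightarrow> det (mat \<mu> - map_matrix complex_of_real A) = 0"
    by (metis matrix_left_invertible_ker invertible_left_inverse invertible_det_nz)
  finally show ?thesis .
qed

text \<open>The coefficients are minus the trace, the sum of the principal 2x2 minors and minus the
  determinant, in the shape of \<open>schur_cohn_cubic\<close>.\<close>

lemma complex_eigenvalue_3_iff:
  fixes A :: "real ^ 3 ^ 3"
  shows "complex_eigenvalue A z \<longleftrightarrow>
    z ^ 3 + of_real (- (A$1$1 + A$2$2 + A$3$3)) * z\<^sup>2
      + of_real (A$1$1 * A$2$2 - A$1$2 * A$2$1 + A$1$1 * A$3$3 - A$1$3 * A$3$1
          + A$2$2 * A$3$3 - A$2$3 * A$3$2) * z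
      + of_real (- det A) = 0"
  unfolding complex_eigenvalue_iff_det
  by (simp add: det_3 mat_def map_matrix_def power3_eq_cube power2_eq_square algebra_simps)

section \<open>The Jacobian of the map\<close>

text \<open>Repeated entries reflect that the second coordinate of the map depends only on
  \<open>x + z\<close>, and the third on \<open>x\<close>, \<open>y\<close> only through
  \<open>x + y\<close>.\<close>

definition tlnb_jacobian :: "real \<Rightarrow> real \<Rightarrow> real \<Rightarrow> real \<Rightarrow> real ^ 3 \<Rightarrow> real ^ 3 ^ 3" where
  "tlnb_jacobian c1 c2 c3 k p =
    (let x = p $ 1; y = p $ 2; z = p $ 3; s = x + y + z;
         q = 1 / (2 * c2 * sqrt ((x + z) / c2)) - 1;
         d = k * z * (1 / s\<^sup>2 - 2 * (x + y) / s ^ 3)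
     in vector
       [vector [1 - c1 * s, 1 / 2 - c1 * s, 1 / 2 - c1 * s],
        vector [q, 0, q],
        vector [d, d, 1 + k * ((x + y) / s\<^sup>2 - c3) - 2 * k * z * (x + y) / s ^ 3]])"

text \<open>Differentiation goes coordinate by coordinate; the hypotheses keep the quotient and the
  root away from their singularities.\<close>

lemma tlnb_map_has_derivative:
  assumes "p $ 1 + p $ 2 + p $ 3 \<noteq> 0" and "p $ 1 + p $ 3 > 0" and "c2 > 0"
  shows "(tlnb_map c1 c2 c3 k has_derivative (*v) (tlnb_jacobian c1 c2 c3 k p)) (at p)"
proof -
  note [derivative_intros] = bounded_linear.has_derivative[OF bounded_linear_vec_nth]
  have pos: "(p $ 1 + p $ 3) / c2 > 0" using assms by simp
  have 1: "((\<lambda>p. tlnb_map c1 c2 c3 k p $ 1) has_derivative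
      (\<lambda>h. (tlnb_jacobian c1 c2 c3 k p *v h) $ 1)) (at p)"
    unfolding tlnb_map_def tlnb_jacobian_def Let_def vector_3
    by (rule derivative_eq_intros refl)+
      (simp add: fun_eq_iff matrix_vector_mult_def sum_3 algebra_simps)
  have "((\<lambda>p. (p $ 1 + p $ 3) / c2) has_derivative (\<lambda>h. (h $ 1 + h $ 3) / c2)) (at p)"
    by (rule bounded_linear.has_derivative[OF bounded_linear_divide] derivative_intros)+
  note deriv = has_derivative_real_sqrt[OF _ this]
  have sqrt: "((\<lambda>p. sqrt ((p $ 1 + p $ 3) / c2)) has_derivative
      (\<lambda>h. (h $ 1 + h $ 3) / (2 * c2 * sqrt ((p $ 1 + p $ 3) / c2)))) (at p)"
    by (rule has_derivative_eq_rhs[OF deriv], rule pos) (simp add: fun_eq_iff inverse_eq_divide)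
  have 2: "((\<lambda>p. tlnb_map c1 c2 c3 k p $ 2) has_derivative
      (\<lambda>h. (tlnb_jacobian c1 c2 c3 k p *v h) $ 2)) (at p)"
    unfolding tlnb_map_def tlnb_jacobian_def Let_def vector_3
    by (rule has_derivative_eq_rhs, (rule sqrt derivative_intros)+)
      (simp add: fun_eq_iff matrix_vector_mult_def sum_3 algebra_simps add_divide_distrib)
  define s where "s = p $ 1 + p $ 2 + p $ 3"
  have s: "s \<noteq> 0" using assms by (simp add: s_def)
  have quot: "((\<lambda>p. (p $ 1 + p $ 2) / (p $ 1 + p $ 2 + p $ 3)\<^sup>2) has_derivative
      (\<lambda>h. (h $ 1 + h $ 2) / (p $ 1 + p $ 2 + p $ 3)\<^sup>2
        - 2 * (p $ 1 + p $ 2) * (h $ 1 + h $ 2 + h $ 3) / (p $ 1 + p $ 2 + p $ 3) ^ 3)) (at p)"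
    by (rule has_derivative_eq_rhs, rule has_derivative_divide', (rule derivative_intros)+,
      use assms in simp)
      (fold s_def, use s in \<open>simp add: fun_eq_iff field_simps power2_eq_square power3_eq_cube\<close>)
  have 3: "((\<lambda>p. tlnb_map c1 c2 c3 k p $ 3) has_derivative
      (\<lambda>h. (tlnb_jacobian c1 c2 c3 k p *v h) $ 3)) (at p)"
    unfolding tlnb_map_def tlnb_jacobian_def Let_def vector_3
    by (rule has_derivative_eq_rhs, (rule quot derivative_intros)+)
      (simp add: fun_eq_iff matrix_vector_mult_def sum_3 algebra_simps add_divide_distrib diff_divide_distrib)
  have "((\<lambda>p. tlnb_map c1 c2 c3 k p $ i) has_derivative
      (\<lambda>h. (tlnb_jacobian c1 c2 c3 k p *v h) $ i)) (at p)" for i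
    using exhaust_3[of i] by (elim disjE) (simp_all only: 1 2 3)
  then show ?thesis
    by (subst has_derivative_componentwise_within) (auto simp: Basis_vec_def inner_axis)
qed

lemma jacobian_unique:
  fixes A :: "real ^ 'n ^ 'm"
  assumes "(f has_derivative (*v) A) (at p)"
  shows "jacobian f (at p) = A"
  by (simp add: jacobian_def flip: frechet_derivative_at[OF assms])

section \<open>The equilibrium and the Jacobian there\<close>

text \<open>In each pairwise sum two parameters cancel, and \<open>(x + z) / c2\<close> becomes a
  perfect square, so no root survives at the equilibrium.\<close>

lemma tlnb_E2_sums:
  assumes "c1 > 0" "c2 > 0" "c3 > 0"
  defines "p \<equiv> tlnb_E2 c1 c2 c3" and "S \<equiv> c1 + c2 + c3"
  shows "p $ 1 + p $ 2 + p $ 3 = 2 / S" "sqrt ((p $ 1 + p $ 3) / c2) = 2 / S"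
    "p $ 1 + p $ 2 = 4 * c3 / S\<^sup>2" "p $ 1 + p $ 3 = 4 * c2 / S\<^sup>2" "p $ 2 + p $ 3 = 4 * c1 / S\<^sup>2"
proof -
  have S: "S > 0" using assms by simp
  show "p $ 1 + p $ 2 = 4 * c3 / S\<^sup>2" and xz: "p $ 1 + p $ 3 = 4 * c2 / S\<^sup>2"
    and "p $ 2 + p $ 3 = 4 * c1 / S\<^sup>2"
    by (simp_all add: p_def tlnb_E2_def flip: S_def add_divide_distrib)
  have "p $ 1 + p $ 2 + p $ 3 = 2 * S / S\<^sup>2"
    by (simp add: p_def tlnb_E2_def S_def flip: add_divide_distrib)
  then show "p $ 1 + p $ 2 + p $ 3 = 2 / S" by (simp add: power2_eq_square)
  have "(p $ 1 + p $ 3) / c2 = (2 / S)\<^sup>2"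
    using assms(2) by (simp add: xz power2_eq_square)
  then show "sqrt ((p $ 1 + p $ 3) / c2) = 2 / S" using S by simp
qed

lemma tlnb_E2_equilibrium:
  assumes "c1 > 0" "c2 > 0" "c3 > 0"
  shows "is_equilibrium (tlnb_map c1 c2 c3 k) (tlnb_E2 c1 c2 c3)"
proof -
  define p where "p = tlnb_E2 c1 c2 c3"
  define S where "S = c1 + c2 + c3"
  have S: "S > 0" using assms by (simp add: S_def)
  note sums = tlnb_E2_sums[OF assms, folded p_def S_def]
  have "1 / 2 * (2 * p $ 1 + p $ 2 + p $ 3 - c1 * (2 / S)\<^sup>2) = p $ 1"
    using sums(5) by (simp add: power2_eq_square)
  moreover have "2 / S - p $ 1 - p $ 3 = p $ 2"
    using sums(1) by linarith
  moreover have "4 * c3 / S\<^sup>2 / (2 / S)\<^sup>2 - c3 = 0"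
    using S by (simp add: power2_eq_square)
  ultimately show ?thesis
    unfolding is_equilibrium_def p_def[symmetric] tlnb_map_def Let_def sums(1,2)
    unfolding sums(3) by (simp add: vec_eq_iff forall_3)
qed

text \<open>The quantity \<open>w\<close> is \<open>k * z * S\<^sup>2 / 4\<close> at the
  equilibrium; \<open>k\<close> enters the matrix only through it.\<close>

lemma tlnb_jacobian_E2:
  fixes c1 c2 c3 k :: real
  assumes "c1 > 0" "c2 > 0" "c3 > 0"
  defines "S \<equiv> c1 + c2 + c3" and "w \<equiv> k * (c1 + c2 - c3) / 2"
  shows "tlnb_jacobian c1 c2 c3 k (tlnb_E2 c1 c2 c3) =
    vector
      [vector [1 - 2 * c1 / S, 1 / 2 - 2 * c1 / S, 1 / 2 - 2 * c1 / S],
       vector [S / (4 * c2) - 1, 0, S / (4 * c2) - 1],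
       vector [w * (1 - 4 * c3 / S), w * (1 - 4 * c3 / S), 1 - 4 * w * c3 / S]]"
proof -
  define p where "p = tlnb_E2 c1 c2 c3"
  have S: "S > 0" using assms by simp
  note sums = tlnb_E2_sums[OF assms(1-3), folded p_def S_def]
  have z: "k * p $ 3 = 4 * w / S\<^sup>2"
    by (simp add: p_def tlnb_E2_def w_def S_def)
  have q: "1 / (2 * c2 * (2 / S)) - 1 = S / (4 * c2) - 1" by simp
  have bracket: "4 * c3 / S\<^sup>2 / (2 / S)\<^sup>2 - c3 = 0"
    using S by (simp add: power2_eq_square)
  have d: "4 * w / S\<^sup>2 * (1 / (2 / S)\<^sup>2 - 2 * (4 * c3 / S\<^sup>2) / (2 / S) ^ 3) = w * (1 - 4 * c3 / S)"
    using S by (simp add: field_simps power2_eq_square power3_eq_cube)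
  have e: "2 * k * p $ 3 * (4 * c3 / S\<^sup>2) / (2 / S) ^ 3 = 4 * w * c3 / S"
  proof -
    have "2 * k * p $ 3 * (4 * c3 / S\<^sup>2) / (2 / S) ^ 3 = 2 * (k * p $ 3) * (4 * c3 / S\<^sup>2) / (2 / S) ^ 3"
      by simp
    also have "\<dots> = 4 * w * c3 / S"
      unfolding z using S by (simp add: field_simps power2_eq_square power3_eq_cube)
    finally show ?thesis .
  qed
  show ?thesis
    unfolding p_def[symmetric] tlnb_jacobian_def Let_def sums(1,2)
    unfolding sums(3) z q bracket d e by (simp add: mult.commute)
qed

lemma locally_stable_tlnb_E2_iff:
  assumes "c1 > 0" "c2 > 0" "c3 > 0"
  shows "locally_stable (tlnb_map c1 c2 c3 k) (tlnb_E2 c1 c2 c3) \<longleftrightarrow>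
    (\<forall>\<mu>. complex_eigenvalue (tlnb_jacobian c1 c2 c3 k (tlnb_E2 c1 c2 c3)) \<mu> \<longrightarrow> cmod \<mu> < 1)"
proof -
  have "(tlnb_map c1 c2 c3 k has_derivative (*v) (tlnb_jacobian c1 c2 c3 k (tlnb_E2 c1 c2 c3)))
      (at (tlnb_E2 c1 c2 c3))"
    using assms by (intro tlnb_map_has_derivative) (simp_all only: tlnb_E2_sums(1,4), simp_all)
  then show ?thesis
    by (auto simp: locally_stable_def jacobian_unique differentiable_def)
qed

lemma strictly_positive_tlnb_E2_iff:
  assumes "c1 > 0" "c2 > 0" "c3 > 0"
  shows "strictly_positive (tlnb_E2 c1 c2 c3) \<longleftrightarrow> c1 < c2 + c3 \<and> c2 < c1 + c3 \<and> c3 < c1 + c2"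
proof -
  have "(c1 + c2 + c3)\<^sup>2 > 0" using assms by simp
  then show ?thesis
    by (auto simp: strictly_positive_def forall_3 tlnb_E2_def zero_less_divide_iff)
qed

section \<open>Stability conditions for the given parameters\<close>

lemma tlnb_E2_stable_iff:
  fixes c k :: real
  assumes "1 / 20 < c" "c < 21 / 20" "k > 0"
  shows "(\<forall>\<mu>. complex_eigenvalue (tlnb_jacobian 0.5 0.55 c k (tlnb_E2 0.5 0.55 c)) \<mu> \<longrightarrow> cmod \<mu> < 1)
    \<longleftrightarrow> LS3 c k < 0 \<and> LS4 c k < 0"
proof -
  \<comment> \<open>\<open>n\<close> is 20 times the sum of the three parameters; \<open>A\<close>,
    \<open>B\<close>, \<open>q\<close>, \<open>w * d\<close> and \<open>1 - e\<close> are the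
    nonzero Jacobian entries up to degeneration at special \<open>n\<close>.\<close>
  define n where "n = 20 * c + 21"
  define A where "A = (n - 20) / n"
  define B where "B = (n - 40) / (2 * n)"
  define q where "q = (n - 44) / 44"
  define w where "w = k * (42 - n) / 40"
  define d where "d = (84 - 3 * n) / n"
  define e where "e = 4 * (n - 21) * w / n"
  define a2 where "a2 = e - 1 - A"
  define a1 where "a1 = A * (1 - e) - B * q - B * w * d - q * w * d"
  define a0 where "a0 = A * q * w * d + B * q * (1 - e) - 2 * B * q * w * d"
  note defs = A_def B_def q_def w_def d_def e_def
  have c: "c = (n - 21) / 20" by (simp add: n_def)
  have n: "22 < n" "n < 42" using assms by (auto simp: n_def)
  have "w > 0" using n assms by (simp add: w_def)
  define J :: "real ^ 3 ^ 3" where "J = vector [vector [A, B, B], vector [q, 0, q], vector [w * d, w * d, 1 - e]]"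
  have J: "tlnb_jacobian 0.5 0.55 c k (tlnb_E2 0.5 0.55 c) = J"
  proof -
    have S: "0.5 + 0.55 + c = n / 20" by (simp add: n_def)
    have entries: "1 - 2 * 0.5 / (n / 20) = A" "1 / 2 - 2 * 0.5 / (n / 20) = B" "n / 20 / (4 * 0.55) - 1 = q"
      "1 - 4 * c / (n / 20) = d" "4 * w * c / (n / 20) = e"
      unfolding A_def B_def q_def d_def e_def c using n by (simp_all add: field_simps)
    have w: "k * (0.5 + 0.55 - c) / 2 = w"
      unfolding w_def c by (simp add: field_simps)
    have "c > 0" using assms by simp
    note E2 = tlnb_jacobian_E2[OF _ _ this, of "0.5" "0.55" k, unfolded S w entries, folded J_def]
    show ?thesis by (rule E2) simp_all
  qed
  have coeffs: "- (J$1$1 + J$2$2 + J$3$3) = a2"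
    "J$1$1 * J$2$2 - J$1$2 * J$2$1 + J$1$1 * J$3$3 - J$1$3 * J$3$1 + J$2$2 * J$3$3 - J$2$3 * J$3$2 = a1"
    "- det J = a0"
    unfolding det_3 J_def vector_3 a2_def a1_def a0_def by (simp_all add: algebra_simps)
  have at_1: "1 + a2 + a1 + a0 = w * n / 44"
    using n by (simp add: a2_def a1_def a0_def defs field_simps power2_eq_square)
  have pos_1: "1 + a2 + a1 + a0 > 0"
    unfolding at_1 using n \<open>w > 0\<close> by simp
  have "1 - a2 + a1 - a0 = - LS3 c k / (1760 * n)"
    using n by (simp add: a2_def a1_def a0_def defs LS3_def c field_simps power2_eq_square power3_eq_cube)
  then have pos_minus_1: "1 - a2 + a1 - a0 > 0 \<longleftrightarrow> LS3 c k < 0"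
    using n by (simp add: divide_less_0_iff)
  \<comment> \<open>The part free of \<open>k\<close> is separated from the part linear in
    \<open>w\<close>; both the determinant condition and \<open>a0 < 1\<close> use this
    form.\<close>
  have a0: "n * a0 = q * (n - 40) / 2 + 2 * q * w * (31 - n)"
    using n by (simp add: a0_def defs field_simps power2_eq_square)
  have "1 - a1 + a2 * a0 - a0\<^sup>2 = - LS4 c k / (38720 * n\<^sup>2)"
  proof -
    have a2: "n * a2 = 4 * (n - 21) * w - 2 * n + 20"
      using n by (simp add: a2_def e_def A_def field_simps)
    \<comment> \<open>The value at 1 eliminates \<open>a1\<close>; since \<open>n * a2\<close> and
      \<open>n * a0\<close> are polynomials, the factor \<open>n\<^sup>2\<close> clears every
      \<open>n\<close> below a fraction bar.\<close>
    have "n\<^sup>2 * (1 - a1 + a2 * a0 - a0\<^sup>2) =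
        n\<^sup>2 * (2 + a2 + a0 - w * n / 44 + a2 * a0 - a0\<^sup>2)"
      using at_1 by simp
    also have "\<dots> = 2 * n\<^sup>2 + n * (n * a2) + n * (n * a0)
        - w * n ^ 3 / 44 + (n * a2) * (n * a0) - (n * a0)\<^sup>2"
      by (simp add: algebra_simps power2_eq_square power3_eq_cube)
    also have "38720 * \<dots> = - LS4 c k"
      unfolding a2 a0 unfolding q_def w_def n_def LS4_def
      by (simp add: field_simps power_numeral_reduce)
    finally show ?thesis using n by (simp add: field_simps)
  qed
  then have pos_det: "1 - a1 + a2 * a0 - a0\<^sup>2 > 0 \<longleftrightarrow> LS4 c k < 0"
    using n by (simp add: divide_less_0_iff)
  have a2: "a2 > - 2"
  proof -
    have "e > 0" using n \<open>w > 0\<close> by (simp add: e_def)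
    moreover have "A < 1" using n by (simp add: A_def)
    ultimately show ?thesis by (simp add: a2_def)
  qed
  \<comment> \<open>The two summands of \<open>n * a0\<close> stay below 7 and 5, and
    \<open>7 + 5 < 22 < n\<close>.\<close>
  have "a0 < 1" if "LS3 c k < 0"
  proof -
    \<comment> \<open>only for n > 31 is LS3 < 0 needed, to bound w\<close>
    have "2 * q * w * (31 - n) < 7"
    proof (cases "c \<le> 1 / 2")
      case True
      then have "q * (w * (31 - n)) \<le> 0"
        using n \<open>w > 0\<close> by (intro mult_nonpos_nonneg) (auto simp: q_def n_def)
      then show ?thesis by (simp add: mult.assoc)
    next
      case False
      \<comment> \<open>\<open>LS3\<close> is affine in \<open>w\<close>, so \<open>LS3 < 0\<close>
        reads \<open>w * P < R\<close>.\<close>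
      define P where "P = 8840 * c - 2000 * c\<^sup>2 - 1361"
      define R where "R = 4360 * c + 1499 - 400 * c\<^sup>2"
      \<comment> \<open>Between 1/2 and 21/20 the square of \<open>c\<close> lies below its chord,
        which reduces the bounds on \<open>P\<close> and \<open>R\<close> to linear ones.\<close>
      have "(2 * c - 1) * (21 - 20 * c) > 0" using False assms by simp
      then have "40 * c\<^sup>2 < 62 * c - 21" by (simp add: algebra_simps power2_eq_square)
      then have "P > 0" and RP: "R < 3 / 2 * P" using False by (simp_all add: P_def R_def)
      have "LS3 c k = 40 * (w * P - R)"
        by (simp add: w_def n_def P_def R_def LS3_def field_simps power2_eq_square power3_eq_cube)
      then have "w * P < 3 / 2 * P" using that RP by simp
      then have "w < 3 / 2" using \<open>P > 0\<close> by simp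
      \<comment> \<open>The maximum, at \<open>n = 75 / 2\<close>, is 42.25.\<close>
      have "(44 - n) * (n - 31) \<le> 43"
        using zero_le_power2[of "2 * n - 75"] by (simp add: algebra_simps power2_eq_square)
      then have "w * ((44 - n) * (n - 31)) \<le> w * 43"
        using \<open>w > 0\<close> by (intro mult_left_mono) auto
      then show ?thesis using \<open>w < 3 / 2\<close> by (simp add: q_def algebra_simps)
    qed
    moreover have "q * (n - 40) / 2 < 5"
    proof -
      \<comment> \<open>The quantity to bound equals
        \<open>9 / 2 - (n - 22) * (62 - n) / 88\<close>.\<close>
      have "(n - 22) * (62 - n) > 0" using n by simp
      then show ?thesis by (simp add: q_def algebra_simps)
    qed
    ultimately have "n * a0 < n * 1" using a0 n by linarith
    then show ?thesis using n by simp
  qed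
  then show ?thesis
    unfolding J complex_eigenvalue_3_iff coeffs schur_cohn_cubic[OF a2] pos_minus_1 pos_det
    using pos_1 by blast
qed

theorem theorem2:
  fixes c3 k :: real
  assumes "c3 > 0" and "k > 0"
  shows
    "is_equilibrium (tlnb_map 0.5 0.55 c3 k) (tlnb_E2 0.5 0.55 c3) \<and>
     strictly_positive (tlnb_E2 0.5 0.55 c3) \<and>
     locally_stable (tlnb_map 0.5 0.55 c3 k) (tlnb_E2 0.5 0.55 c3)
     \<longleftrightarrow>
     LS1 c3 > 0 \<and> LS2 c3 < 0 \<and> LS3 c3 k < 0 \<and> LS4 c3 k < 0"
proof -
  have pos: "0 < (0.5 :: real)" "0 < (0.55 :: real)" by simp_all
  have "strictly_positive (tlnb_E2 0.5 0.55 c3) \<longleftrightarrow> 1 / 20 < c3 \<and> c3 < 21 / 20"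
    unfolding strictly_positive_tlnb_E2_iff[OF pos assms(1)] by auto
  moreover have "is_equilibrium (tlnb_map 0.5 0.55 c3 k) (tlnb_E2 0.5 0.55 c3)"
    by (rule tlnb_E2_equilibrium[OF pos assms(1)])
  \<comment> \<open>The range of \<open>c3\<close> assumed here is supplied by strict positivity on
    one side of the equivalence and by \<open>LS1\<close>, \<open>LS2\<close> on the other.\<close>
  moreover have "locally_stable (tlnb_map 0.5 0.55 c3 k) (tlnb_E2 0.5 0.55 c3) \<longleftrightarrow>
      LS3 c3 k < 0 \<and> LS4 c3 k < 0" if "1 / 20 < c3" "c3 < 21 / 20"
    unfolding locally_stable_tlnb_E2_iff[OF pos assms(1)]
    by (rule tlnb_E2_stable_iff[OF that assms(2)])
  moreover have "LS1 c3 > 0 \<longleftrightarrow> 1 / 20 < c3" "LS2 c3 < 0 \<longleftrightarrow> c3 < 21 / 20"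
    by (auto simp: LS1_def LS2_def)
  ultimately show ?thesis by blast
qed

end
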